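(* Let $k\ge 1$ be an integer and let $G$ be an $(X,Y,a,b)$-graph with $a\ge k$ and $b\ge k$. Let $\lambda_2$ be the second largest eigenvalue of the adjacency matrix of $G$. If $$\lambda_2 < \sqrt{ab} - \frac{(k-1)\sqrt{|X||Y|}}{2\sqrt{\left\lceil\frac{a+1}{2}\right\rceil\left\lceil\frac{b+1}{2}\right\rceil\left(|X|-\left\lceil\frac{b+1}{2}\right\rceil\right)\left(|Y|-\left\lceil\frac{a+1}{2}\right\rceil\right)}},$$ then $\kappa'(G)\ge k$. In particular, if $$\lambda_2 < \sqrt{ab} - \frac{k-1}{\sqrt{\left\lceil\frac{a+1}{2}\right\rceil\left\lceil\frac{b+1}{2}\right\rceil}},$$ then $\kappa'(G)\ge k$.
   Context: All graphs are finite and simple. An $(X,Y,a,b)$-graph is a bipartite graph with bipartition $(X,Y)$ ($X,Y$ nonempty, $a,b$ positive integers) in which every vertex of $X$ has degree $a$ and every vertex of $Y$ has degree $b$ (so $a|X|=b|Y|$); it is not assumed connected. The eigenvalues of the adjacency matrix of $G$ on $n$ vertices are ordered $\lambda_1\ge\lambda_2\ge\cdots\ge\lambda_n$, counted with multiplicity. The edge connectivity $\kappa'(G)$ is the minimum number of edges whose removal produces a disconnected graph; $\kappa'(G)\ge k$ means that $G$ is $k$-edge-connected. *)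

theory Defs
  imports
    Complex_Main
    "HOL-Library.Multiset"
    "HOL-Computational_Algebra.Polynomial"
    "Jordan_Normal_Form.Char_Poly"
begin

text \<open>
  A finite simple graph is given by a finite vertex set \<open>V\<close> and a set \<open>E\<close> of
  two-element subsets of \<open>V\<close>.
\<close>

definition simple_graph :: "'a set \<Rightarrow> 'a set set \<Rightarrow> bool" where
  "simple_graph V E \<longleftrightarrow> finite V \<and> (\<forall>e\<in>E. e \<subseteq> V \<and> card e = 2)"

definition degree_of :: "'a set set \<Rightarrow> 'a \<Rightarrow> nat" where
  "degree_of E v = card {e \<in> E. v \<in> e}"

definition XYab_graph :: "'a set \<Rightarrow> 'a set \<Rightarrow> nat \<Rightarrow> nat \<Rightarrow> 'a set set \<Rightarrow> bool" where
  "XYab_graph X Y a b E \<longleftrightarrow>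
     simple_graph (X \<union> Y) E \<and>
     X \<noteq> {} \<and> Y \<noteq> {} \<and> X \<inter> Y = {} \<and> a > 0 \<and> b > 0 \<and>
     (\<forall>e\<in>E. \<exists>x\<in>X. \<exists>y\<in>Y. e = {x, y}) \<and>
     (\<forall>x\<in>X. degree_of E x = a) \<and>
     (\<forall>y\<in>Y. degree_of E y = b)"

definition connected_graph :: "'a set \<Rightarrow> 'a set set \<Rightarrow> bool" where
  "connected_graph V E \<longleftrightarrow> (\<forall>u\<in>V. \<forall>v\<in>V. (u, v) \<in> {(x, y). {x, y} \<in> E}\<^sup>*)"

text \<open>
  For a finite simple graph with at least two vertices the set below is nonempty, as removing
  all edges disconnects the graph. For the one-vertex graph it is empty, and the infimum is 0.
\<close>

definition edge_connectivity :: "'a set \<Rightarrow> 'a set set \<Rightarrow> nat" where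
  "edge_connectivity V E = Inf {card F |F. F \<subseteq> E \<and> \<not> connected_graph V (E - F)}"

text \<open>
  The list \<open>vs\<close> enumerates the vertices without repetition; it only fixes the order in which
  they index the rows and columns.
\<close>

definition adjacency_matrix :: "'a list \<Rightarrow> 'a set set \<Rightarrow> real mat" where
  "adjacency_matrix vs E =
     mat (length vs) (length vs) (\<lambda>(i, j). if {vs ! i, vs ! j} \<in> E then 1 else 0)"

text \<open>
  The real eigenvalues, listed in nonincreasing order and repeated according to their
  multiplicity as roots of the characteristic polynomial; for a symmetric matrix these are all
  the eigenvalues, and algebraic and geometric multiplicities agree. The indices \<open>i\<close>
  of \<open>nth_eigenvalue A i\<close> start at 1.
\<close>

definition eigenvalue_list :: "real mat \<Rightarrow> real list" where
  "eigenvalue_list A = rev (sorted_list_of_multiset (proots (char_poly A)))"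

definition nth_eigenvalue :: "real mat \<Rightarrow> nat \<Rightarrow> real" where
  "nth_eigenvalue A i = eigenvalue_list A ! (i - 1)"

end

theory Submission
  imports Defs "Jordan_Normal_Form.Schur_Decomposition"
begin

text \<open>
  Suppose that fewer than \<open>k\<close> edges can be removed so that the graph falls apart, and let \<open>S\<close>
  be a union of components of what remains. Write \<open>X\<^sub>1 = X \<inter> S\<close>, \<open>X\<^sub>2 = X - S\<close>, \<open>Y\<^sub>1 = Y \<inter> S\<close>,
  \<open>Y\<^sub>2 = Y - S\<close>, use lower-case letters for the sizes, and let \<open>e\<^sub>i\<^sub>j\<close> be the number of edges between
  \<open>X\<^sub>i\<close> and \<open>Y\<^sub>j\<close>, so that \<open>m = e\<^sub>1\<^sub>2 + e\<^sub>2\<^sub>1 < k\<close> edges cross the cut. Two facts contradict a small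
  second eigenvalue.

  The parts are large. If \<open>2 y\<^sub>1 \<le> a\<close>, a vertex of \<open>X\<^sub>1\<close> has at most half of its neighbours
  inside \<open>S\<close>, and comparing degree sums shows that at least \<open>min a b \<ge> k\<close> edges leave \<open>S\<close>. Hence
  \<open>y\<^sub>i \<ge> \<alpha>\<close> and, by symmetry, \<open>x\<^sub>i \<ge> \<beta>\<close> (\<open>small_cut_part_size\<close>).

  A small cut forces a large second eigenvalue:
  \<open>\<lambda>\<^sub>2 \<ge> sqrt (a b) - m sqrt (|X| |Y|) / (2 sqrt (x\<^sub>1 x\<^sub>2 y\<^sub>1 y\<^sub>2))\<close>
  (\<open>second_eigenvalue_ge_of_cut\<close>). By the Courant-Fischer principle it is enough to bound the Rayleigh
  quotient from below on a plane of functions. The plane is spanned by the function with value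
  \<open>sqrt a\<close> on \<open>X\<close> and \<open>sqrt b\<close> on \<open>Y\<close>, which is the eigenvector for \<open>sqrt (a b)\<close>, and by a function
  orthogonal to it that is constant on the four parts and changes sign across the cut. Scaling the
  latter so that its restrictions to \<open>X\<close> and \<open>Y\<close> have equal norm reduces the bound to one
  application of the inequality of arithmetic and geometric means (\<open>two_block_rayleigh\<close>).

  Since \<open>\<beta> \<le> x\<^sub>1, x\<^sub>2\<close> gives \<open>x\<^sub>1 x\<^sub>2 \<ge> \<beta> (|X| - \<beta>)\<close>, and likewise for \<open>Y\<close>, the first criterion follows;
  the second one is a consequence of it, because \<open>|X| \<ge> 2 \<beta>\<close> and \<open>|Y| \<ge> 2 \<alpha>\<close>.

  The Courant-Fischer principle is derived from the spectral theorem for real symmetric matrices,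
  in a form that ties the diagonal to the roots of the characteristic polynomial with multiplicity.
\<close>

section \<open>The spectral theorem for real symmetric matrices\<close>

text \<open>
  Complete the vector to a basis, orthogonalise by Gram-Schmidt, which keeps the first vector, and
  normalise.
\<close>

lemma unit_vector_extends_to_orthogonal_matrix:
  fixes v :: "real vec"
  assumes v: "v \<in> carrier_vec n" and unit: "v \<bullet> v = 1"
  obtains W where "W \<in> carrier_mat n n" and "transpose_mat W * W = 1\<^sub>m n" and "col W 0 = v"
proof -
  interpret cof_vec_space n "TYPE(real)" .
  have v0: "v \<noteq> 0\<^sub>v n"
    using unit v by auto
  hence n: "0 < n"
    using v by (cases n) auto
  define b where "b = basis_completion v"
  define ws where "ws = gram_schmidt n b"
  from basis_completion[OF v v0, folded b_def]
  have b: "distinct b" "\<not> lin_dep (set b)" "set b \<subseteq> carrier_vec n" "hd b = v" "length b = n"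
    by auto
  then obtain vs where bv: "b = v # vs"
    using n by (cases b) auto
  from gram_schmidt_result[OF b(3,1,2) refl, folded ws_def]
  have ws: "set ws \<subseteq> carrier_vec n" "corthogonal ws" "length ws = n"
    using b by auto
  have "hd ws = v"
    using gram_schmidt_hd[OF v, of vs] unfolding ws_def bv .
  hence ws0: "ws ! 0 = v"
    using ws(3) n by (cases ws) auto
  have wsc: "ws ! i \<in> carrier_vec n" if "i < n" for i
    using ws that by (metis nth_mem subsetD)
  have orth: "ws ! i \<bullet> ws ! j = 0 \<longleftrightarrow> i \<noteq> j" if "i < n" "j < n" for i j
    using corthogonalD[OF ws(2), of i j] that ws(3) by (simp add: vec_conjugate_real)
  define u where "u i = (1 / sqrt (ws ! i \<bullet> ws ! i)) \<cdot>\<^sub>v (ws ! i)" for i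
  define W where "W = mat_of_cols n (map u [0..<n])"
  have uc: "u i \<in> carrier_vec n" if "i < n" for i
    unfolding u_def using wsc[OF that] by simp
  have uu: "u i \<bullet> u j = (if i = j then 1 else 0)" if "i < n" "j < n" for i j
  proof -
    have "0 \<le> ws ! i \<bullet> ws ! i"
      by (simp add: scalar_prod_def sum_nonneg)
    hence "0 < ws ! i \<bullet> ws ! i"
      using orth[of i i] that by simp
    thus ?thesis
      using orth[OF that] wsc[OF that(1)] wsc[OF that(2)]
      by (auto simp: u_def)
  qed
  have Wc: "W \<in> carrier_mat n n"
    using mat_of_cols_carrier(1)[of n "map u [0..<n]"] unfolding W_def by simp
  have colW: "col W i = u i" if "i < n" for i
    unfolding W_def using that uc[OF that] by (subst col_mat_of_cols) auto
  have "transpose_mat W * W = 1\<^sub>m n"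
    using Wc by (intro eq_matI) (auto simp: colW uu)
  moreover have "col W 0 = v"
    using n unit v by (simp add: colW u_def ws0)
  ultimately show ?thesis
    using Wc that by blast
qed

text \<open>
  Deflation by induction on the list of roots. In an orthonormal basis that starts with an
  eigenvector for the first root \<open>e\<close>, the first column of the matrix is \<open>e\<close> times a unit vector, and by
  symmetry so is the first row. The remaining diagonal block is again symmetric, and its
  characteristic polynomial is the original one divided by \<open>[:- e, 1:]\<close>. Because the order of the
  roots is prescribed, the eigenvalues appear on the diagonal in any order that the user wants.
\<close>

lemma real_spectral_theorem:
  fixes A :: "real mat"
  assumes "A \<in> carrier_mat n n" and "transpose_mat A = A"
    and "char_poly A = (\<Prod>e\<leftarrow>es. [:- e, 1:])"
  shows "\<exists>P \<in> carrier_mat n n. transpose_mat P * P = 1\<^sub>m n \<and>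
    transpose_mat P * A * P = mat_diag n (\<lambda>i. es ! i)"
  using assms
proof (induction es arbitrary: n A)
  case Nil
  hence "n = 0"
    using degree_monic_char_poly[of A n] by simp
  thus ?case
    using Nil.prems(1) by (intro bexI[of _ "1\<^sub>m 0"]) (auto simp: mat_diag_def)
next
  case (Cons e es)
  note A = Cons.prems(1) and sym = Cons.prems(2)
  have cp: "char_poly A = [:- e, 1:] * (\<Prod>e\<leftarrow>es. [:- e, 1:])"
    using Cons.prems(3) by simp
  have "eigenvalue A e"
    unfolding eigenvalue_root_char_poly[OF A] cp by simp
  then obtain v0 where v0: "v0 \<in> carrier_vec n" "v0 \<noteq> 0\<^sub>v n" "A *\<^sub>v v0 = e \<cdot>\<^sub>v v0"
    unfolding eigenvalue_def eigenvector_def using A by auto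
  define v where "v = (1 / sqrt (v0 \<bullet> v0)) \<cdot>\<^sub>v v0"
  have v: "v \<in> carrier_vec n" and Av: "A *\<^sub>v v = e \<cdot>\<^sub>v v"
    unfolding v_def using v0 A
    by (auto simp: mult_mat_vec smult_smult_assoc mult.commute)
  have "0 < v0 \<bullet> v0"
    using conjugate_square_greater_0_vec[OF v0(1)] v0(2) by (simp add: vec_conjugate_real)
  hence vv: "v \<bullet> v = 1"
    unfolding v_def using v0(1) by (simp add: field_simps)
  obtain W where W: "W \<in> carrier_mat n n" and WW: "transpose_mat W * W = 1\<^sub>m n"
    and col0: "col W 0 = v"
    using unit_vector_extends_to_orthogonal_matrix[OF v vv] .
  let ?Wt = "transpose_mat W"
  have Wt: "?Wt \<in> carrier_mat n n"
    using W by simp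
  have WW': "W * ?Wt = 1\<^sub>m n"
    by (rule mat_mult_left_right_inverse[OF Wt W WW])
  define A' where "A' = ?Wt * A * W"
  have A': "A' \<in> carrier_mat n n"
    unfolding A'_def using W A by auto
  have symA': "transpose_mat A' = A'"
    unfolding A'_def using W A sym
    by (simp add: transpose_mult[of _ n n _ n] assoc_mult_mat[of _ n n _ n _ n])
  obtain m where n: "n = Suc m"
    using v0 by (cases n) auto
  have "col A' 0 = ?Wt *\<^sub>v (A *\<^sub>v col W 0)"
  proof -
    have "col A' 0 = (?Wt * A) *\<^sub>v col W 0"
      unfolding A'_def using Wt A n by (intro col_mult2[OF _ W]) auto
    also have "\<dots> = ?Wt *\<^sub>v (A *\<^sub>v col W 0)"
      unfolding col0 by (rule assoc_mult_mat_vec[OF Wt A v])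
    finally show ?thesis .
  qed
  also have "\<dots> = e \<cdot>\<^sub>v (?Wt *\<^sub>v col W 0)"
    using Av Wt v by (simp add: col0 mult_mat_vec)
  also have "?Wt *\<^sub>v col W 0 = col (?Wt * W) 0"
    using n by (intro col_mult2[OF Wt W, symmetric]) simp
  also have "\<dots> = unit_vec n 0"
    using n by (simp add: WW)
  finally have "col A' 0 = e \<cdot>\<^sub>v unit_vec n 0" .
  hence A'0: "A' $$ (i, 0) = (if i = 0 then e else 0)" if "i < n" for i
    using A' that n by (metis (no_types, lifting) carrier_matD col_def index_smult_vec(1) index_unit_vec(1) index_vec index_unit_vec(3) mult.right_neutral mult_zero_right zero_less_Suc)
  have A'0': "A' $$ (0, i) = (if i = 0 then e else 0)" if "i < n" for i
    using A'0[OF that] symA' A' that n by (metis carrier_matD index_transpose_mat(1) zero_less_Suc)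
  define A3 where "A3 = mat m m (\<lambda>(i, j). A' $$ (Suc i, Suc j))"
  let ?e = "mat 1 1 (\<lambda>_. e)"
  have A3: "A3 \<in> carrier_mat m m"
    unfolding A3_def by simp
  have block: "A' = four_block_mat ?e (0\<^sub>m 1 m) (0\<^sub>m m 1) A3"
    using A' A'0 A'0' n by (intro eq_matI) (auto simp: A3_def less_Suc_eq_0_disj)
  have symA3: "transpose_mat A3 = A3"
  proof (rule eq_matI)
    fix i j assume "i < dim_row A3" "j < dim_col A3"
    thus "transpose_mat A3 $$ (i, j) = A3 $$ (i, j)"
      using arg_cong[OF symA', of "\<lambda>M. M $$ (Suc i, Suc j)"] A' n by (simp add: A3_def)
  qed (auto simp: A3_def)
  have "similar_mat_wit A' A ?Wt W"
    using W A A' WW WW' by (intro similar_mat_witI[of _ _ n]) (auto simp: A'_def)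
  hence "char_poly A' = char_poly A"
    using char_poly_similar unfolding similar_mat_def by blast
  moreover have "char_poly A' = char_poly ?e * char_poly A3"
    unfolding block by (rule char_poly_four_block_zeros_col[OF _ _ A3]) auto
  moreover have "char_poly ?e = [:- e, 1:]"
    by (simp add: char_poly_defs det_def sign_def)
  ultimately have "char_poly A3 = (\<Prod>e\<leftarrow>es. [:- e, 1:])"
    using cp by (metis mult_cancel_left pCons_eq_0_iff zero_neq_one)
  from Cons.IH[OF A3 symA3 this]
  obtain P3 where P3: "P3 \<in> carrier_mat m m" "transpose_mat P3 * P3 = 1\<^sub>m m"
    "transpose_mat P3 * A3 * P3 = mat_diag m (\<lambda>i. es ! i)"
    by blast
  define Q where "Q = four_block_mat (1\<^sub>m 1) (0\<^sub>m 1 m) (0\<^sub>m m 1) P3"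
  have Q: "Q \<in> carrier_mat n n"
    unfolding Q_def using P3 n by auto
  have Qt: "transpose_mat Q = four_block_mat (1\<^sub>m 1) (0\<^sub>m 1 m) (0\<^sub>m m 1) (transpose_mat P3)"
    unfolding Q_def using P3 by (subst transpose_four_block_mat) auto
  have QQ: "transpose_mat Q * Q = 1\<^sub>m n"
    unfolding Qt unfolding Q_def using P3 n
    by (subst mult_four_block_mat[of _ 1 1 _ m _ m _ _ 1 _ m]) auto
  have "transpose_mat Q * A' = four_block_mat ?e (0\<^sub>m 1 m) (0\<^sub>m m 1) (transpose_mat P3 * A3)"
    unfolding Qt block using P3 A3
    by (subst mult_four_block_mat[of _ 1 1 _ m _ m _ _ 1 _ m]) auto
  hence "transpose_mat Q * A' * Q = four_block_mat ?e (0\<^sub>m 1 m) (0\<^sub>m m 1) (mat_diag m (\<lambda>i. es ! i))"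
    unfolding Q_def P3(3)[symmetric] using P3 A3
    by (simp, subst mult_four_block_mat[of _ 1 1 _ m _ m _ _ 1 _ m]) auto
  also have "\<dots> = mat_diag n (\<lambda>i. (e # es) ! i)"
    using n by (intro eq_matI) (auto simp: mat_diag_def)
  finally have QAQ: "transpose_mat Q * A' * Q = mat_diag n (\<lambda>i. (e # es) ! i)" .
  have tWQ: "transpose_mat (W * Q) = transpose_mat Q * ?Wt"
    using W Q by (simp add: transpose_mult[of _ n n _ n])
  have Qtc: "transpose_mat Q \<in> carrier_mat n n"
    using Q by simp
  have "transpose_mat (W * Q) * (W * Q) = transpose_mat Q * ((?Wt * W) * Q)"
    unfolding tWQ using W Wt Q Qtc by (simp add: assoc_mult_mat[of _ n n _ n _ n])
  hence "transpose_mat (W * Q) * (W * Q) = 1\<^sub>m n"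
    using Q QQ by (simp add: WW)
  moreover have "transpose_mat (W * Q) * A * (W * Q) = transpose_mat Q * A' * Q"
    unfolding tWQ A'_def using W Wt Q Qtc A by (simp add: assoc_mult_mat[of _ n n _ n _ n])
  ultimately show ?case
    using W Q QAQ by (intro bexI[of _ "W * Q"]) auto
qed

text \<open>
  Over the complex numbers the polynomial splits. A root \<open>a\<close> with eigenvector \<open>v\<close> is real, because
  moving the symmetric real matrix from one side of \<open>v \<bullet> conjugate v\<close> to the other replaces \<open>a\<close> by its
  conjugate.
\<close>

lemma symmetric_real_char_poly_splits:
  fixes A :: "real mat"
  assumes A: "A \<in> carrier_mat n n" and sym: "transpose_mat A = A"
  obtains es where "char_poly A = (\<Prod>e\<leftarrow>es. [:- e, 1:])" and "length es = n"
proof -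
  let ?C = "map_mat complex_of_real A"
  have C: "?C \<in> carrier_mat n n"
    using A by simp
  obtain as where as: "char_poly ?C = (\<Prod>a\<leftarrow>as. [:- a, 1:])" "length as = n"
    using char_poly_factorized[OF C] by blast
  have real: "complex_of_real (Re a) = a" if "a \<in> set as" for a
  proof -
    have "poly (char_poly ?C) a = 0"
      unfolding as(1) poly_prod_list using that by (force simp: prod_list_zero_iff)
    hence "eigenvalue ?C a"
      using eigenvalue_root_char_poly[OF C] by simp
    then obtain v where v: "v \<in> carrier_vec n" "v \<noteq> 0\<^sub>v n" "?C *\<^sub>v v = a \<cdot>\<^sub>v v"
      unfolding eigenvalue_def eigenvector_def using C by auto
    have cv: "conjugate v \<in> carrier_vec n"
      using v by simp
    have "conjugate (?C *\<^sub>v v) = ?C *\<^sub>v conjugate v"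
      using A v(1) by (intro eq_vecI) (auto simp: scalar_prod_def)
    hence Ccv: "?C *\<^sub>v conjugate v = cnj a \<cdot>\<^sub>v conjugate v"
      using v by (simp add: conjugate_smult_vec)
    have symC: "transpose_mat ?C = ?C"
      using sym by (metis map_mat_transpose)
    have "a * (v \<bullet> conjugate v) = (?C *\<^sub>v v) \<bullet> conjugate v"
      using v cv by simp
    also have "\<dots> = v \<bullet> (?C *\<^sub>v conjugate v)"
      using transpose_vec_mult_scalar[OF C v(1) cv] transpose_vec_mult_scalar[OF C cv v(1)] symC C v cv
      by (metis comm_scalar_prod mult_mat_vec_carrier)
    also have "\<dots> = cnj a * (v \<bullet> conjugate v)"
      using v cv by (simp add: Ccv)
    finally have "a = cnj a"
      using conjugate_square_eq_0_vec[OF v(1)] v(2) by simp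
    thus ?thesis
      by (metis Reals_cnj_iff of_real_Re)
  qed
  interpret ofr: map_poly_inj_comm_ring_hom complex_of_real
    by standard auto
  have "map_poly complex_of_real (char_poly A) = char_poly ?C"
    by (rule of_real_hom.char_poly_hom[OF A, symmetric])
  also have "\<dots> = map_poly complex_of_real (\<Prod>e\<leftarrow>map Re as. [:- e, 1:])"
    unfolding as(1) using real
    by (induction as) (auto simp: ofr.hom_mult simp del: mult_pCons_left)
  finally have "char_poly A = (\<Prod>e\<leftarrow>map Re as. [:- e, 1:])"
    using ofr.injectivity by blast
  thus ?thesis
    using that as(2) by (metis length_map)
qed

section \<open>A lower bound for the second eigenvalue\<close>

text \<open>
  For a symmetric matrix the list has full length. Without this, indexing it at the second position
  would not refer to an eigenvalue.
\<close>

lemma eigenvalue_list_symmetric: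
  fixes A :: "real mat"
  assumes A: "A \<in> carrier_mat n n" and sym: "transpose_mat A = A"
  shows "char_poly A = (\<Prod>e\<leftarrow>eigenvalue_list A. [:- e, 1:])"
    and "length (eigenvalue_list A) = n"
    and "sorted (rev (eigenvalue_list A))"
proof -
  obtain es where es: "char_poly A = (\<Prod>e\<leftarrow>es. [:- e, 1:])" "length es = n"
    using symmetric_real_char_poly_splits[OF A sym] .
  have "proots (\<Prod>e\<leftarrow>es. [:- e, 1:]) = mset es"
  proof (induction es)
    case (Cons e es)
    have "(\<Prod>e\<leftarrow>es. [:- e, 1:]) \<noteq> 0"
      by (induction es) (auto simp del: mult_pCons_left)
    thus ?case
      using Cons by (simp add: proots_mult del: mult_pCons_left)
  qed simp
  hence list: "eigenvalue_list A = rev (sort es)"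
    unfolding eigenvalue_list_def es(1) by simp
  have "mset (eigenvalue_list A) = mset es"
    unfolding list by simp
  thus "char_poly A = (\<Prod>e\<leftarrow>eigenvalue_list A. [:- e, 1:])"
    unfolding es(1) by (metis mset_map prod_mset_prod_list)
  show "length (eigenvalue_list A) = n" "sorted (rev (eigenvalue_list A))"
    unfolding list using es(2) by simp_all
qed

text \<open>
  Every plane contains a nonzero vector \<open>w\<close> that is orthogonal to the first eigenvector. On the
  orthogonal complement of that eigenvector the Rayleigh quotient is at most the second eigenvalue.
\<close>

lemma courant_fischer_second_eigenvalue:
  fixes A :: "real mat"
  assumes A: "A \<in> carrier_mat n n" and sym: "transpose_mat A = A"
    and f: "f \<in> carrier_vec n" and g: "g \<in> carrier_vec n"
    and indep: "\<And>s t. (s, t) \<noteq> (0, 0) \<Longrightarrow> s \<cdot>\<^sub>v f + t \<cdot>\<^sub>v g \<noteq> 0\<^sub>v n"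
    and rayleigh: "\<And>s t. let w = s \<cdot>\<^sub>v f + t \<cdot>\<^sub>v g in c * (w \<bullet> w) \<le> w \<bullet> (A *\<^sub>v w)"
  shows "c \<le> nth_eigenvalue A 2"
proof -
  let ?es = "eigenvalue_list A"
  note es = eigenvalue_list_symmetric[OF A sym]
  obtain P where P: "P \<in> carrier_mat n n" "transpose_mat P * P = 1\<^sub>m n"
    "transpose_mat P * A * P = mat_diag n (\<lambda>i. ?es ! i)"
    using real_spectral_theorem[OF A sym es(1)] by blast
  let ?Pt = "transpose_mat P"
  have Pt: "?Pt \<in> carrier_mat n n"
    using P by simp
  have PP: "P * ?Pt = 1\<^sub>m n"
    by (rule mat_mult_left_right_inverse[OF Pt P(1,2)])
  \<comment> \<open>A combination of the two vectors whose first coordinate in the eigenbasis vanishes.\<close>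
  obtain s t where st: "(s, t) \<noteq> (0, 0)" "s * (?Pt *\<^sub>v f) $ 0 + t * (?Pt *\<^sub>v g) $ 0 = 0"
  proof (cases "(?Pt *\<^sub>v f) $ 0 = 0")
    case True
    thus ?thesis using that[of 1 0] by simp
  next
    case False
    thus ?thesis using that[of "(?Pt *\<^sub>v g) $ 0" "- (?Pt *\<^sub>v f) $ 0"] by simp
  qed
  define w where "w = s \<cdot>\<^sub>v f + t \<cdot>\<^sub>v g"
  define z where "z = ?Pt *\<^sub>v w"
  have w: "w \<in> carrier_vec n" and z: "z \<in> carrier_vec n"
    unfolding w_def z_def using f g Pt by auto
  have wz: "w = P *\<^sub>v z"
    unfolding z_def using w P Pt PP by (simp flip: assoc_mult_mat_vec)
  have w0: "w \<noteq> 0\<^sub>v n"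
    unfolding w_def by (rule indep[OF st(1)])
  hence z0: "z \<noteq> 0\<^sub>v n"
    unfolding wz using P by auto
  then obtain i where i: "i < n" "z $ i \<noteq> 0"
    using z by (metis carrier_vecD dim_vec eq_vecI index_zero_vec(1) zero_carrier_vec)
  have "z = s \<cdot>\<^sub>v (?Pt *\<^sub>v f) + t \<cdot>\<^sub>v (?Pt *\<^sub>v g)"
    unfolding z_def w_def using f g Pt by (simp add: mult_add_distrib_mat_vec[of _ n n] mult_mat_vec)
  hence z_first: "z $ 0 = 0"
    using st(2) i(1) f g P by simp
  have "i \<noteq> 0"
    using i z_first by (metis)
  \<comment> \<open>A nonzero coordinate besides the first one exists, so there is a second eigenvalue.\<close>
  hence n: "2 \<le> n"
    using i by simp
  have ww: "w \<bullet> w = z \<bullet> z"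
    using transpose_vec_mult_scalar[OF P(1) z w] unfolding wz[symmetric] z_def[symmetric] ..
  have Aw: "A *\<^sub>v w \<in> carrier_vec n"
    using A w by simp
  have "w \<bullet> (A *\<^sub>v w) = (A *\<^sub>v w) \<bullet> (P *\<^sub>v z)"
    unfolding wz[symmetric] by (rule comm_scalar_prod[OF w Aw])
  also have "\<dots> = (?Pt *\<^sub>v (A *\<^sub>v w)) \<bullet> z"
    by (rule transpose_vec_mult_scalar[OF P(1) z Aw, symmetric])
  also have "\<dots> = z \<bullet> (?Pt *\<^sub>v (A *\<^sub>v (P *\<^sub>v z)))"
    unfolding wz[symmetric] using Aw Pt z by (intro comm_scalar_prod[of _ n]) auto
  also have "\<dots> = z \<bullet> (mat_diag n (\<lambda>i. ?es ! i) *\<^sub>v z)"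
    unfolding P(3)[symmetric] using P(1) Pt A z
    by (simp add: assoc_mult_mat_vec[of _ n n _ n])
  also have "\<dots> = (\<Sum>i<n. ?es ! i * (z $ i)\<^sup>2)"
  proof -
    have "(mat_diag n (\<lambda>i. ?es ! i) *\<^sub>v z) $ i = ?es ! i * z $ i" if "i < n" for i
      using that z unfolding mat_diag_def
      by (simp add: scalar_prod_def if_distrib[of "\<lambda>x. x * _"] cong: if_cong)
    thus ?thesis
      using z unfolding scalar_prod_def
      by (simp add: mat_diag_def lessThan_atLeast0 power2_eq_square ac_simps)
  qed
  also have "\<dots> \<le> (\<Sum>i<n. ?es ! 1 * (z $ i)\<^sup>2)"
  proof (rule sum_mono)
    fix i assume i: "i \<in> {..<n}"
    show "?es ! i * (z $ i)\<^sup>2 \<le> ?es ! 1 * (z $ i)\<^sup>2"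
    proof (cases "i = 0")
      case False
      hence "?es ! i \<le> ?es ! 1"
        using es(2,3) i n by (intro sorted_rev_nth_mono) auto
      thus ?thesis
        by (intro mult_right_mono) auto
    qed (simp add: z_first)
  qed
  also have "\<dots> = ?es ! 1 * (z \<bullet> z)"
    using z by (simp add: scalar_prod_def lessThan_atLeast0 power2_eq_square sum_distrib_left)
  finally have "c * (z \<bullet> z) \<le> ?es ! 1 * (z \<bullet> z)"
    using rayleigh[of s t] unfolding Let_def w_def[symmetric] ww by linarith
  moreover have "0 < z \<bullet> z"
    using conjugate_square_greater_0_vec[OF z] z0 by (simp add: vec_conjugate_real)
  ultimately show ?thesis
    unfolding nth_eigenvalue_def by simp
qed

section \<open>Edge counts and the quadratic form of the adjacency matrix\<close>

definition adj :: "'a set set \<Rightarrow> 'a \<Rightarrow> 'a \<Rightarrow> real" where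
  "adj E u w = (if {u, w} \<in> E then 1 else 0)"

definition edge_count :: "'a set set \<Rightarrow> 'a set \<Rightarrow> 'a set \<Rightarrow> real" where
  "edge_count E S T = (\<Sum>u\<in>S. \<Sum>w\<in>T. adj E u w)"

lemma adj_commute: "adj E u w = adj E w u"
  by (simp add: adj_def insert_commute)

lemma edge_count_commute: "edge_count E S T = edge_count E T (S :: 'a set)"
proof -
  have "edge_count E S T = (\<Sum>w\<in>T. \<Sum>u\<in>S. adj E u w)"
    unfolding edge_count_def by (rule sum.swap)
  also have "\<dots> = (\<Sum>w\<in>T. \<Sum>u\<in>S. adj E w u)"
    by (intro sum.cong refl adj_commute)
  finally show ?thesis
    unfolding edge_count_def .
qed

lemma edge_count_nonneg: "0 \<le> edge_count E S T"
  unfolding edge_count_def by (intro sum_nonneg) (simp add: adj_def)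

lemma edge_count_le: "edge_count E S T \<le> real (card S) * real (card T)"
proof -
  have "edge_count E S T \<le> (\<Sum>u\<in>S. \<Sum>w\<in>T. 1)"
    unfolding edge_count_def by (intro sum_mono) (simp add: adj_def)
  thus ?thesis
    by simp
qed

lemma edge_count_eq_card:
  assumes "finite S" "finite T"
  shows "edge_count E S T = real (card {p \<in> S \<times> T. {fst p, snd p} \<in> E})"
proof -
  have "edge_count E S T = (\<Sum>p\<in>S \<times> T. if {fst p, snd p} \<in> E then 1 else 0)"
    unfolding edge_count_def adj_def by (simp add: sum.cartesian_product case_prod_beta)
  also have "\<dots> = (\<Sum>p\<in>{p \<in> S \<times> T. {fst p, snd p} \<in> E}. 1)"
    using assms by (intro sum.inter_filter[symmetric]) simp
  finally show ?thesis
    by simp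
qed

lemma edge_count_split_left:
  assumes "finite S"
  shows "edge_count E (S \<inter> R) T + edge_count E (S - R) T = edge_count E S T"
  unfolding edge_count_def using sum.Int_Diff[OF assms, symmetric] .

lemma edge_count_split_right:
  assumes "finite T"
  shows "edge_count E S (T \<inter> R) + edge_count E S (T - R) = edge_count E S T"
  using edge_count_split_left[OF assms, of E R S] by (simp add: edge_count_commute[of E S])

text \<open>
  The coordinate vector of a function on the vertices, in the order that indexes the adjacency
  matrix. With it, sums over matrix indices become sums over vertices.
\<close>

definition restrict_to_vertices :: "'a list \<Rightarrow> ('a \<Rightarrow> real) \<Rightarrow> real vec" where
  "restrict_to_vertices vs h = vec (length vs) (\<lambda>i. h (vs ! i))"

lemma sum_over_enumeration:
  fixes g :: "'a \<Rightarrow> real"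
  assumes "distinct vs"
  shows "(\<Sum>i = 0..<length vs. g (vs ! i)) = (\<Sum>v\<in>set vs. g v)"
  using sum.reindex_bij_betw[OF bij_betw_nth[OF assms refl refl], of g]
  by (simp add: lessThan_atLeast0)

lemma square_norm_restrict:
  assumes "distinct vs"
  shows "restrict_to_vertices vs h \<bullet> restrict_to_vertices vs h = (\<Sum>v\<in>set vs. (h v)\<^sup>2)"
  using sum_over_enumeration[OF assms, of "\<lambda>v. (h v)\<^sup>2"]
  by (simp add: restrict_to_vertices_def scalar_prod_def power2_eq_square)

lemma adjacency_quadratic_form:
  assumes "distinct vs"
  shows "restrict_to_vertices vs h \<bullet> (adjacency_matrix vs E *\<^sub>v restrict_to_vertices vs h)
    = (\<Sum>u\<in>set vs. \<Sum>w\<in>set vs. adj E u w * h u * h w)"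
proof -
  let ?h = "restrict_to_vertices vs h"
  have "(adjacency_matrix vs E *\<^sub>v ?h) $ i = (\<Sum>w\<in>set vs. adj E (vs ! i) w * h w)"
    if "i < length vs" for i
    using that sum_over_enumeration[OF assms, of "\<lambda>w. adj E (vs ! i) w * h w"]
    by (simp add: adjacency_matrix_def restrict_to_vertices_def scalar_prod_def adj_def)
  hence "?h \<bullet> (adjacency_matrix vs E *\<^sub>v ?h)
      = (\<Sum>i = 0..<length vs. h (vs ! i) * (\<Sum>w\<in>set vs. adj E (vs ! i) w * h w))"
    by (simp add: scalar_prod_def adjacency_matrix_def)
      (simp add: restrict_to_vertices_def)
  also have "\<dots> = (\<Sum>u\<in>set vs. h u * (\<Sum>w\<in>set vs. adj E u w * h w))"
    by (rule sum_over_enumeration[OF assms])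
  finally show ?thesis
    by (simp add: sum_distrib_left ac_simps)
qed

lemma adjacency_matrix_symmetric:
  "transpose_mat (adjacency_matrix vs E) = adjacency_matrix vs E"
  by (intro eq_matI) (auto simp: adjacency_matrix_def insert_commute)

section \<open>Biregular bipartite graphs\<close>

lemma XYab_graphE:
  assumes "XYab_graph X Y a b E" and "e \<in> E"
  obtains x y where "x \<in> X" "y \<in> Y" "e = {x, y}"
proof -
  have "\<forall>e\<in>E. \<exists>x\<in>X. \<exists>y\<in>Y. e = {x, y}"
    using assms(1) unfolding XYab_graph_def by (elim conjE)
  thus ?thesis
    using assms(2) that by blast
qed

text \<open>
  The two sides play symmetric roles. Facts below are proved for \<open>X\<close> and transferred to \<open>Y\<close>
  by exchanging them.
\<close>

lemma XYab_graph_swap: "XYab_graph X Y a b E \<Longrightarrow> XYab_graph Y X b a E"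
proof -
  assume G: "XYab_graph X Y a b E"
  have "\<exists>y\<in>Y. \<exists>x\<in>X. e = {y, x}" if e: "e \<in> E" for e
  proof -
    obtain x y where "x \<in> X" "y \<in> Y" "e = {x, y}"
      by (rule XYab_graphE[OF G e])
    hence "e = {y, x}" "x \<in> X" "y \<in> Y"
      by auto
    thus ?thesis
      by blast
  qed
  moreover have "Y \<union> X = X \<union> Y" "Y \<inter> X = X \<inter> Y"
    by auto
  ultimately show ?thesis
    using G unfolding XYab_graph_def by simp
qed

lemma XYab_graph_finite:
  assumes "XYab_graph X Y a b E"
  shows "finite X" "finite Y" "finite E"
proof -
  have fin: "finite (X \<union> Y)" and "E \<subseteq> Pow (X \<union> Y)"
    using assms unfolding XYab_graph_def simple_graph_def by auto
  thus "finite E"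
    by (meson finite_Pow_iff finite_subset)
  show "finite X" "finite Y"
    using fin by auto
qed

lemma adj_within_X:
  assumes G: "XYab_graph X Y a b E" and u: "u \<in> X" and w: "w \<in> X"
  shows "adj E u w = 0"
proof -
  have "{u, w} \<notin> E"
  proof
    assume "{u, w} \<in> E"
    then obtain x y where "x \<in> X" "y \<in> Y" "{u, w} = {x, y}"
      by (rule XYab_graphE[OF G])
    moreover have "X \<inter> Y = {}"
      using G unfolding XYab_graph_def by simp
    moreover have "y \<in> {u, w}"
      using calculation by simp
    ultimately show False
      using u w by blast
  qed
  thus ?thesis
    by (simp add: adj_def)
qed

lemma adj_sum_X:
  assumes G: "XYab_graph X Y a b E" and x: "x \<in> X"
  shows "(\<Sum>y\<in>Y. adj E x y) = real a"
proof -
  note fin = XYab_graph_finite[OF G]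
  have disj: "X \<inter> Y = {}"
    using G unfolding XYab_graph_def by simp
  have "bij_betw (\<lambda>y. {x, y}) {y \<in> Y. {x, y} \<in> E} {e \<in> E. x \<in> e}"
  proof (rule bij_betw_imageI)
    show "inj_on (\<lambda>y. {x, y}) {y \<in> Y. {x, y} \<in> E}"
      by (auto simp: inj_on_def doubleton_eq_iff)
    have "\<exists>y\<in>Y. e = {x, y}" if e: "e \<in> E" "x \<in> e" for e
    proof -
      obtain x' y where "x' \<in> X" "y \<in> Y" "e = {x', y}"
        by (rule XYab_graphE[OF G e(1)])
      thus ?thesis
        using e(2) x disj by auto
    qed
    thus "(\<lambda>y. {x, y}) ` {y \<in> Y. {x, y} \<in> E} = {e \<in> E. x \<in> e}"
      by blast
  qed
  hence "card {y \<in> Y. {x, y} \<in> E} = degree_of E x"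
    unfolding degree_of_def by (rule bij_betw_same_card)
  moreover have "degree_of E x = a"
    using G x unfolding XYab_graph_def by simp
  moreover have "(\<Sum>y\<in>Y. adj E x y) = real (card {y \<in> Y. {x, y} \<in> E})"
    unfolding adj_def using fin by (simp flip: sum.inter_filter)
  ultimately show ?thesis
    by simp
qed

lemma edge_count_degree:
  assumes G: "XYab_graph X Y a b E" and S: "S \<subseteq> X"
  shows "edge_count E S Y = real a * real (card S)"
proof -
  have "edge_count E S Y = (\<Sum>x\<in>S. real a)"
    unfolding edge_count_def using adj_sum_X[OF G] S by (intro sum.cong) auto
  thus ?thesis
    by simp
qed

lemma bipartite_quadratic_form:
  assumes G: "XYab_graph X Y a b E"
  shows "(\<Sum>u\<in>X \<union> Y. \<Sum>w\<in>X \<union> Y. adj E u w * h u * h w)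
    = 2 * (\<Sum>x\<in>X. \<Sum>y\<in>Y. adj E x y * h x * h y)"
proof -
  note fin = XYab_graph_finite[OF G]
  have disj: "X \<inter> Y = {}"
    using G unfolding XYab_graph_def by simp
  note zero = adj_within_X[OF G] adj_within_X[OF XYab_graph_swap[OF G]]
  have "(\<Sum>u\<in>Y. \<Sum>w\<in>X. adj E u w * h u * h w) = (\<Sum>w\<in>X. \<Sum>u\<in>Y. adj E u w * h u * h w)"
    by (rule sum.swap)
  also have "\<dots> = (\<Sum>x\<in>X. \<Sum>y\<in>Y. adj E x y * h x * h y)"
    by (intro sum.cong refl) (simp add: adj_commute[of E _ "_ :: 'a"] ac_simps)
  finally show ?thesis
    using fin disj by (simp add: sum.union_disjoint sum.distrib zero)
qed

section \<open>Small cuts and the sizes of their parts\<close>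

text \<open>
  Remove a minimum disconnecting set \<open>F\<close> and let \<open>S\<close> be the set of vertices that remain reachable
  from one end of a separated pair. Every edge between \<open>S\<close> and its complement lies in \<open>F\<close>. The sets
  over which the minimum is taken exist because removing all edges separates a vertex of \<open>X\<close> from one
  of \<open>Y\<close>.
\<close>

lemma small_cut_of_edge_connectivity:
  assumes G: "XYab_graph X Y a b E"
  obtains S where "S \<inter> (X \<union> Y) \<noteq> {}" and "(X \<union> Y) - S \<noteq> {}"
    and "edge_count E (X \<inter> S) (Y - S) + edge_count E (X - S) (Y \<inter> S)
           \<le> real (edge_connectivity (X \<union> Y) E)"
proof -
  let ?V = "X \<union> Y"
  let ?C = "{card F |F. F \<subseteq> E \<and> \<not> connected_graph ?V (E - F)}"
  note fin = XYab_graph_finite[OF G]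
  have disj: "X \<inter> Y = {}" and "X \<noteq> {}" "Y \<noteq> {}"
    using G unfolding XYab_graph_def by simp_all
  then obtain x y where xy: "x \<in> X" "y \<in> Y" "x \<noteq> y"
    by blast
  hence "\<not> connected_graph ?V (E - E)"
    unfolding connected_graph_def by (intro notI) (auto dest!: bspec[of _ _ x] bspec[of _ _ y])
  hence "?C \<noteq> {}"
    by blast
  hence "edge_connectivity ?V E \<in> ?C"
    unfolding edge_connectivity_def by (rule Inf_nat_def1)
  then obtain F where F: "F \<subseteq> E" "\<not> connected_graph ?V (E - F)" "edge_connectivity ?V E = card F"
    by blast
  then obtain u v where uv: "u \<in> ?V" "v \<in> ?V" "(u, v) \<notin> {(x, y). {x, y} \<in> E - F}\<^sup>*"
    unfolding connected_graph_def by blast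
  let ?R = "{(x, y). {x, y} \<in> E - F}"
  define S where "S = {w. (u, w) \<in> ?R\<^sup>*}"
  have cross: "{p, q} \<in> F" if "{p, q} \<in> E" "p \<in> S" "q \<notin> S" for p q
  proof (rule ccontr)
    assume "{p, q} \<notin> F"
    hence "(p, q) \<in> ?R"
      using that by simp
    thus False
      using that unfolding S_def by (auto intro: rtrancl_into_rtrancl)
  qed
  let ?P = "\<lambda>A B. {p \<in> A \<times> B. {fst p, snd p} \<in> E}"
  let ?P1 = "?P (X \<inter> S) (Y - S)" and ?P2 = "?P (X - S) (Y \<inter> S)"
  have finP: "finite ?P1" "finite ?P2"
    using fin by auto
  have inj: "inj_on (\<lambda>p. {fst p, snd p}) (?P1 \<union> ?P2)"
    using disj by (auto simp: inj_on_def doubleton_eq_iff)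
  have "(\<lambda>p. {fst p, snd p}) ` (?P1 \<union> ?P2) \<subseteq> F"
  proof
    fix e assume "e \<in> (\<lambda>p. {fst p, snd p}) ` (?P1 \<union> ?P2)"
    then obtain p q where pq: "e = {p, q}" "{p, q} \<in> E" "p \<in> S \<and> q \<notin> S \<or> q \<in> S \<and> p \<notin> S"
      by auto
    moreover have "{q, p} = {p, q}"
      by auto
    ultimately show "e \<in> F"
      using cross[of p q] cross[of q p] by auto
  qed
  hence "card (?P1 \<union> ?P2) \<le> card F"
    using card_inj_on_le[OF inj] finite_subset[OF F(1) fin(3)] by blast
  moreover have "card (?P1 \<union> ?P2) = card ?P1 + card ?P2"
    using finP by (intro card_Un_disjoint) auto
  ultimately have "edge_count E (X \<inter> S) (Y - S) + edge_count E (X - S) (Y \<inter> S) \<le> real (card F)"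
    using fin by (simp add: edge_count_eq_card flip: of_nat_add)
  moreover have "u \<in> S" "v \<notin> S"
    using uv unfolding S_def by auto
  ultimately show ?thesis
    using that[of S] uv F(3) by auto
qed

text \<open>
  One side of the cut has \<open>x\<close> vertices in \<open>X\<close> and \<open>y\<close> in \<open>Y\<close>; it contains \<open>e\<close> edges, and \<open>d\<close> and \<open>d'\<close> edges
  leave it from its vertices in \<open>X\<close> and in \<open>Y\<close>. Adding the two degree sums and using \<open>e \<le> x y\<close> gives
  \<open>d + d' \<ge> x (a - 2 y) + b y\<close>. If \<open>2 y \<le> a\<close>, the right-hand side is at least \<open>b \<ge> k\<close> when \<open>y > 0\<close>, and
  at least \<open>a \<ge> k\<close> when \<open>y = 0\<close>, since then \<open>x > 0\<close>. So \<open>2 y \<ge> a + 1\<close>, and since \<open>y\<close> is an integer this survives rounding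
  up.
\<close>

lemma small_cut_part_size:
  fixes x y a b :: nat and e d d' k :: real
  assumes "0 < x \<or> 0 < y" and "k \<le> real a" and "k \<le> real b"
    and "e \<le> real x * real y" and "0 \<le> d" and "0 \<le> d'"
    and "e + d = real a * real x" and "e + d' = real b * real y" and "d + d' < k"
  shows "real_of_int \<lceil>(real a + 1) / 2\<rceil> \<le> real y"
proof -
  have "a < 2 * y"
  proof (rule ccontr)
    assume "\<not> a < 2 * y"
    hence 2: "2 * real y \<le> real a"
      by linarith
    show False
    proof (cases "y = 0")
      case True
      hence "1 \<le> real x"
        using assms(1) by simp
      hence "real a * 1 \<le> real a * real x"
        by (intro mult_left_mono) auto
      moreover have "e \<le> 0"
        using assms(4) True by simp
      ultimately show False
        using assms(2,5-7,9) by linarith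
    next
      case False
      hence "real b * 1 \<le> real b * real y"
        by (intro mult_left_mono) auto
      moreover have "real x * (2 * real y) \<le> real x * real a"
        using 2 by (intro mult_left_mono) auto
      hence "2 * (real x * real y) \<le> real a * real x"
        by (simp add: ac_simps)
      ultimately show False
        using assms(3-9) by linarith
    qed
  qed
  hence "(real a + 1) / 2 \<le> real_of_int (int y)"
    by simp
  hence "\<lceil>(real a + 1) / 2\<rceil> \<le> int y"
    by (simp only: ceiling_le_iff)
  thus ?thesis
    by linarith
qed

section \<open>Test functions that are constant on the parts of a cut\<close>

definition block_function :: "'a set \<Rightarrow> 'a set \<Rightarrow> real \<Rightarrow> real \<Rightarrow> real \<Rightarrow> real \<Rightarrow> 'a \<Rightarrow> real" where
  "block_function X S p1 p2 q1 q2 v =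
     (if v \<in> X then if v \<in> S then p1 else p2 else if v \<in> S then q1 else q2)"

lemma block_function_values:
  assumes "X \<inter> Y = {}"
  shows "v \<in> X \<inter> S \<Longrightarrow> block_function X S p1 p2 q1 q2 v = p1"
    and "v \<in> X - S \<Longrightarrow> block_function X S p1 p2 q1 q2 v = p2"
    and "v \<in> Y \<inter> S \<Longrightarrow> block_function X S p1 p2 q1 q2 v = q1"
    and "v \<in> Y - S \<Longrightarrow> block_function X S p1 p2 q1 q2 v = q2"
  using assms by (auto simp: block_function_def)

lemma block_function_square_sum:
  assumes G: "XYab_graph X Y a b E"
  shows "(\<Sum>v\<in>X \<union> Y. (block_function X S p1 p2 q1 q2 v)\<^sup>2)
    = real (card (X \<inter> S)) * p1\<^sup>2 + real (card (X - S)) * p2\<^sup>2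
      + real (card (Y \<inter> S)) * q1\<^sup>2 + real (card (Y - S)) * q2\<^sup>2"
proof -
  let ?h = "block_function X S p1 p2 q1 q2"
  note fin = XYab_graph_finite[OF G]
  have disj: "X \<inter> Y = {}"
    using G unfolding XYab_graph_def by simp
  have const: "(\<Sum>v\<in>A. (?h v)\<^sup>2) = real (card A) * p\<^sup>2" if "\<And>v. v \<in> A \<Longrightarrow> ?h v = p" for A p
    using that by simp
  have "(\<Sum>v\<in>X \<union> Y. (?h v)\<^sup>2) = (\<Sum>v\<in>X. (?h v)\<^sup>2) + (\<Sum>v\<in>Y. (?h v)\<^sup>2)"
    using fin disj by (simp add: sum.union_disjoint)
  also have "(\<Sum>v\<in>X. (?h v)\<^sup>2) = real (card (X \<inter> S)) * p1\<^sup>2 + real (card (X - S)) * p2\<^sup>2"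
    unfolding sum.Int_Diff[OF fin(1), of _ S]
    by (intro arg_cong2[where f = "(+)"] const block_function_values[OF disj])
  also have "(\<Sum>v\<in>Y. (?h v)\<^sup>2) = real (card (Y \<inter> S)) * q1\<^sup>2 + real (card (Y - S)) * q2\<^sup>2"
    unfolding sum.Int_Diff[OF fin(2), of _ S]
    by (intro arg_cong2[where f = "(+)"] const block_function_values[OF disj])
  finally show ?thesis
    by simp
qed

lemma block_function_quadratic_form:
  assumes G: "XYab_graph X Y a b E"
  shows "(\<Sum>u\<in>X \<union> Y. \<Sum>w\<in>X \<union> Y.
      adj E u w * block_function X S p1 p2 q1 q2 u * block_function X S p1 p2 q1 q2 w)
    = 2 * (edge_count E (X \<inter> S) (Y \<inter> S) * p1 * q1 + edge_count E (X \<inter> S) (Y - S) * p1 * q2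
         + edge_count E (X - S) (Y \<inter> S) * p2 * q1 + edge_count E (X - S) (Y - S) * p2 * q2)"
proof -
  define h where "h = block_function X S p1 p2 q1 q2"
  let ?sum = "\<lambda>A B. \<Sum>x\<in>A. \<Sum>y\<in>B. adj E x y * h x * h y"
  note fin = XYab_graph_finite[OF G]
  have disj: "X \<inter> Y = {}"
    using G unfolding XYab_graph_def by simp
  note h = block_function_values[OF disj, of _ S p1 p2 q1 q2, folded h_def]
  have const: "?sum A B = edge_count E A B * p * q"
    if "\<And>x. x \<in> A \<Longrightarrow> h x = p" "\<And>y. y \<in> B \<Longrightarrow> h y = q" for A B p q
    using that by (simp add: edge_count_def sum_distrib_right)
  have "?sum X Y = ?sum (X \<inter> S) Y + ?sum (X - S) Y"
    by (rule sum.Int_Diff[OF fin(1)])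
  moreover have "?sum A Y = ?sum A (Y \<inter> S) + ?sum A (Y - S)" for A
    by (simp only: sum.Int_Diff[OF fin(2), of _ S] sum.distrib)
  moreover have "?sum (X \<inter> S) (Y \<inter> S) = edge_count E (X \<inter> S) (Y \<inter> S) * p1 * q1"
    "?sum (X \<inter> S) (Y - S) = edge_count E (X \<inter> S) (Y - S) * p1 * q2"
    "?sum (X - S) (Y \<inter> S) = edge_count E (X - S) (Y \<inter> S) * p2 * q1"
    "?sum (X - S) (Y - S) = edge_count E (X - S) (Y - S) * p2 * q2"
    by (rule const; erule h)+
  ultimately show ?thesis
    unfolding h_def[symmetric] bipartite_quadratic_form[OF G] by simp
qed

text \<open>
  The computation behind the eigenvalue bound. The parameter \<open>s\<close> multiplies the eigenvector for
  \<open>sqrt (a b)\<close>, and \<open>t\<close> the test function that changes sign across the cut. The factors \<open>x\<^sub>2, - x\<^sub>1\<close>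
  and \<open>y\<^sub>2, - y\<^sub>1\<close> make that function sum to zero over each side, so that no mixed term \<open>s t\<close> appears in
  either quadratic form; \<open>\<tau>\<close> equalises the norms of its two restrictions.

  The \<open>s\<close>-part of the inequality says that \<open>c \<le> sqrt (a b)\<close>. With \<open>D = sqrt (x\<^sub>1 x\<^sub>2 y\<^sub>1 y\<^sub>2)\<close> the
  \<open>t\<close>-part reduces to \<open>b D \<le> a x\<^sub>1 x\<^sub>2 + \<delta> (x\<^sub>1 - x\<^sub>2) / 2\<close> with \<open>\<delta> = e\<^sub>1\<^sub>2 - e\<^sub>2\<^sub>1\<close>. As
  \<open>b y\<^sub>1 = a x\<^sub>1 - \<delta>\<close> and \<open>b y\<^sub>2 = a x\<^sub>2 + \<delta>\<close>, this follows from the inequality between the geometric and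
  the arithmetic mean of \<open>a\<^sup>2 x\<^sub>1 x\<^sub>2\<close> and \<open>b\<^sup>2 y\<^sub>1 y\<^sub>2\<close>.
\<close>

lemma two_block_rayleigh:
  fixes a b x1 x2 y1 y2 e11 e12 e21 e22 :: real
  assumes pos: "0 < a" "0 < b" "0 < x1" "0 < x2" "0 < y1" "0 < y2"
    and X1: "e11 + e12 = a * x1" and X2: "e21 + e22 = a * x2"
    and Y1: "e11 + e21 = b * y1" and Y2: "e12 + e22 = b * y2"
    and m: "0 \<le> e12 + e21"
  defines "\<tau> \<equiv> sqrt (x1 * x2 / (y1 * y2))"
    and "c \<equiv> sqrt (a * b) - (e12 + e21) * sqrt ((x1 + x2) * (y1 + y2)) / (2 * sqrt (x1 * x2 * y1 * y2))"
  defines "p1 \<equiv> \<lambda>s t. sqrt a * (s + t * x2)" and "p2 \<equiv> \<lambda>s t. sqrt a * (s - t * x1)"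
    and "q1 \<equiv> \<lambda>s t. sqrt b * (s + t * \<tau> * y2)" and "q2 \<equiv> \<lambda>s t. sqrt b * (s - t * \<tau> * y1)"
  shows "x1 * (p1 s t)\<^sup>2 + x2 * (p2 s t)\<^sup>2 + y1 * (q1 s t)\<^sup>2 + y2 * (q2 s t)\<^sup>2
      = 2 * a * (x1 + x2) * (s\<^sup>2 + t\<^sup>2 * x1 * x2)" (is "?N = _")
    and "c * (x1 * (p1 s t)\<^sup>2 + x2 * (p2 s t)\<^sup>2 + y1 * (q1 s t)\<^sup>2 + y2 * (q2 s t)\<^sup>2)
      \<le> 2 * (e11 * p1 s t * q1 s t + e12 * p1 s t * q2 s t
            + e21 * p2 s t * q1 s t + e22 * p2 s t * q2 s t)" (is "_ \<le> ?Q")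
proof -
  define D where "D = sqrt (x1 * x2 * y1 * y2)"
  define r where "r = sqrt (a * b)"
  have D: "0 < D" and D2: "D * D = x1 * x2 * y1 * y2"
    using pos by (simp_all add: D_def)
  have r: "0 < r" and r2: "r * r = a * b"
    using pos by (simp_all add: r_def)
  have bal: "a * (x1 + x2) = b * (y1 + y2)"
    using X1 X2 Y1 Y2 by (simp add: algebra_simps)
  have tau2: "\<tau> * \<tau> * (y1 * y2) = x1 * x2"
    using pos by (simp add: \<tau>_def)
  have "\<tau> * D = sqrt ((x1 * x2)\<^sup>2)"
    unfolding \<tau>_def D_def using pos
    by (simp flip: real_sqrt_mult add: power2_eq_square field_simps)
  hence tauD: "\<tau> * D = x1 * x2"
    using pos by simp
  have sq: "(sqrt a)\<^sup>2 = a" "(sqrt b)\<^sup>2 = b" "sqrt a * sqrt b = r"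
    using pos by (simp_all add: r_def real_sqrt_mult)
  have "?N = a * (x1 * (s + t * x2)\<^sup>2 + x2 * (s - t * x1)\<^sup>2)
      + b * (y1 * (s + t * \<tau> * y2)\<^sup>2 + y2 * (s - t * \<tau> * y1)\<^sup>2)"
    unfolding p1_def p2_def q1_def q2_def power_mult_distrib sq by (simp add: algebra_simps)
  also have "\<dots> = a * (x1 + x2) * (s\<^sup>2 + t\<^sup>2 * x1 * x2)
      + b * (y1 + y2) * (s\<^sup>2 + t\<^sup>2 * (\<tau> * \<tau> * (y1 * y2)))"
    by (simp add: algebra_simps power2_eq_square)
  finally show N: "?N = 2 * a * (x1 + x2) * (s\<^sup>2 + t\<^sup>2 * x1 * x2)"
    unfolding tau2 bal[symmetric] by (simp add: algebra_simps)

  have Q: "?Q = 2 * r * (a * (x1 + x2) * s\<^sup>2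
      + t\<^sup>2 * \<tau> * (y1 + y2) * (a * x1 * x2 - e12 * x2 - e21 * x1))"
  proof -
    have "?Q = 2 * (sqrt a * sqrt b) * (e11 * (s + t * x2) * (s + t * \<tau> * y2)
        + e12 * (s + t * x2) * (s - t * \<tau> * y1) + e21 * (s - t * x1) * (s + t * \<tau> * y2)
        + e22 * (s - t * x1) * (s - t * \<tau> * y1))"
      unfolding p1_def p2_def q1_def q2_def by (simp add: algebra_simps)
    also have "\<dots> = 2 * r * (((e11 + e12) + (e21 + e22)) * s\<^sup>2
        + s * t * ((e11 + e12) * x2 - (e21 + e22) * x1
          + \<tau> * ((e11 + e21) * y2 - (e12 + e22) * y1))
        + t\<^sup>2 * \<tau> * (e11 * x2 * y2 - e12 * x2 * y1 - e21 * x1 * y2 + e22 * x1 * y1))"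
      unfolding sq by (simp add: algebra_simps power2_eq_square)
    also have "e11 * x2 * y2 - e12 * x2 * y1 - e21 * x1 * y2 + e22 * x1 * y1
        = (a * x1 - e12) * x2 * y2 - e12 * x2 * y1 - e21 * x1 * y2 + (a * x2 - e21) * x1 * y1"
      unfolding X1[symmetric] X2[symmetric] by simp
    finally show ?thesis
      unfolding X1 X2 Y1 Y2 by (simp add: algebra_simps)
  qed

  have amgm: "b * D \<le> a * x1 * x2 + (e12 - e21) * (x1 - x2) / 2"
  proof -
    have prod: "(b * y1) * (b * y2) = (a * x1 - (e12 - e21)) * (a * x2 + (e12 - e21))"
    proof -
      have "b * y1 = a * x1 - (e12 - e21)" "b * y2 = a * x2 + (e12 - e21)"
        using X1 X2 Y1 Y2 by linarith+
      thus ?thesis by simp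
    qed
    have "(a * (b * D))\<^sup>2 = (a * x1) * (a * x2) * ((b * y1) * (b * y2))"
      using D2 by (simp add: power2_eq_square algebra_simps)
    also have "\<dots> \<le> (((a * x1) * (a * x2) + (b * y1) * (b * y2)) / 2)\<^sup>2"
      using arith_geo_mean_sqrt[of "(a * x1) * (a * x2)" "(b * y1) * (b * y2)"] pos
      by (intro sqrt_le_D) simp
    finally have "a * (b * D) \<le> ((a * x1) * (a * x2) + (b * y1) * (b * y2)) / 2"
      by (rule power2_le_imp_le) (use pos in simp)
    also have "\<dots> \<le> a * (a * x1 * x2 + (e12 - e21) * (x1 - x2) / 2)"
    proof -
      have "((a * x1) * (a * x2) + (b * y1) * (b * y2)) / 2
          = a * (a * x1 * x2 + (e12 - e21) * (x1 - x2) / 2) - (e12 - e21)\<^sup>2 / 2"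
        unfolding prod by (simp add: field_simps power2_eq_square)
      thus ?thesis
        by simp
    qed
    finally show ?thesis
      using pos by simp
  qed

  \<comment> \<open>The balance \<open>a (x\<^sub>1 + x\<^sub>2) = b (y\<^sub>1 + y\<^sub>2)\<close> removes the square root from the numerator of \<open>c\<close>.\<close>
  have "sqrt ((x1 + x2) * (y1 + y2)) = a * (x1 + x2) / r"
  proof (rule real_sqrt_unique)
    show "(a * (x1 + x2) / r)\<^sup>2 = (x1 + x2) * (y1 + y2)"
    proof -
      have "(a * (x1 + x2) / r)\<^sup>2 = (a * (x1 + x2)) * (a * (x1 + x2)) / (r * r)"
        by (simp add: power2_eq_square)
      also have "\<dots> = (a * (x1 + x2)) * (b * (y1 + y2)) / (a * b)"
        unfolding r2 using bal by simp
      finally show ?thesis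
        using pos by simp
    qed
  qed (use pos r in simp)
  hence "c = r - (e12 + e21) * a * (x1 + x2) / (2 * r * D)"
    unfolding c_def r_def[symmetric] D_def[symmetric] by simp
  hence cD: "c * D * r = a * (b * D - (e12 + e21) * (x1 + x2) / 2)"
    using D r r2 by (simp add: field_simps)
  also have "\<dots> \<le> a * (a * x1 * x2 - e12 * x2 - e21 * x1)"
    using amgm pos(1) by (intro mult_left_mono) (simp_all add: field_simps)
  finally have "c * D * r * r \<le> r * a * (a * x1 * x2 - e12 * x2 - e21 * x1)"
    using r by (simp add: mult.commute mult_left_mono)
  hence "c * D * b \<le> r * (a * x1 * x2 - e12 * x2 - e21 * x1)"
    using pos by (simp add: mult.assoc r2)
  hence "c * D * b * (\<tau> * (y1 + y2))
      \<le> r * (a * x1 * x2 - e12 * x2 - e21 * x1) * (\<tau> * (y1 + y2))"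
    using pos by (intro mult_right_mono) (auto simp: \<tau>_def)
  also have "c * D * b * (\<tau> * (y1 + y2)) = c * (\<tau> * D) * (b * (y1 + y2))"
    by (simp add: ac_simps)
  finally have t_part: "c * (a * (x1 + x2) * x1 * x2)
      \<le> r * \<tau> * (y1 + y2) * (a * x1 * x2 - e12 * x2 - e21 * x1)"
    unfolding tauD bal[symmetric] by (simp add: ac_simps)
  have "c \<le> r"
    unfolding c_def r_def using pos m by simp
  hence s_part: "c * (a * (x1 + x2) * s\<^sup>2) \<le> r * (a * (x1 + x2) * s\<^sup>2)"
    using pos by (intro mult_right_mono) auto
  have "c * (2 * a * (x1 + x2) * (s\<^sup>2 + t\<^sup>2 * x1 * x2))
      = 2 * (c * (a * (x1 + x2) * s\<^sup>2)) + 2 * t\<^sup>2 * (c * (a * (x1 + x2) * x1 * x2))"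
    by (simp add: algebra_simps)
  also have "\<dots> \<le> 2 * (r * (a * (x1 + x2) * s\<^sup>2))
      + 2 * t\<^sup>2 * (r * \<tau> * (y1 + y2) * (a * x1 * x2 - e12 * x2 - e21 * x1))"
    using s_part t_part by (intro add_mono mult_left_mono) auto
  also have "\<dots> = ?Q"
    unfolding Q by (simp add: algebra_simps)
  finally show "c * ?N \<le> ?Q"
    unfolding N .
qed

text \<open>
  The plane for the Courant-Fischer principle is spanned by \<open>f\<close> and \<open>g\<close>; the closed form of the squared
  norm in \<open>two_block_rayleigh\<close> also shows that it is two-dimensional.
\<close>

lemma second_eigenvalue_ge_of_cut:
  fixes S :: "'a set"
  assumes G: "XYab_graph X Y a b E" and vs: "distinct vs" "set vs = X \<union> Y"
  defines "x1 \<equiv> real (card (X \<inter> S))" and "x2 \<equiv> real (card (X - S))"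
    and "y1 \<equiv> real (card (Y \<inter> S))" and "y2 \<equiv> real (card (Y - S))"
    and "m \<equiv> edge_count E (X \<inter> S) (Y - S) + edge_count E (X - S) (Y \<inter> S)"
  assumes pos: "0 < x1" "0 < x2" "0 < y1" "0 < y2"
  shows "sqrt (real a * real b) - m * sqrt (real (card X) * real (card Y)) / (2 * sqrt (x1 * x2 * y1 * y2))
    \<le> nth_eigenvalue (adjacency_matrix vs E) 2" (is "?c \<le> _")
proof -
  note fin = XYab_graph_finite[OF G]
  note G' = XYab_graph_swap[OF G]
  have ab: "0 < real a" "0 < real b"
    using G unfolding XYab_graph_def by simp_all
  let ?e11 = "edge_count E (X \<inter> S) (Y \<inter> S)" and ?e12 = "edge_count E (X \<inter> S) (Y - S)"
    and ?e21 = "edge_count E (X - S) (Y \<inter> S)" and ?e22 = "edge_count E (X - S) (Y - S)"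
  have X1: "?e11 + ?e12 = real a * x1" and X2: "?e21 + ?e22 = real a * x2"
    unfolding x1_def x2_def edge_count_split_right[OF fin(2)]
    by (intro edge_count_degree[OF G]; blast)+
  have Y1: "?e11 + ?e21 = real b * y1" and Y2: "?e12 + ?e22 = real b * y2"
    unfolding y1_def y2_def edge_count_split_left[OF fin(1)] edge_count_commute[of E X]
    by (intro edge_count_degree[OF G']; blast)+
  have m: "0 \<le> ?e12 + ?e21"
    by (simp add: edge_count_nonneg)
  have cardX: "real (card X) = x1 + x2" and cardY: "real (card Y) = y1 + y2"
    unfolding x1_def x2_def y1_def y2_def
    using card_Int_Diff[OF fin(1), of S] card_Int_Diff[OF fin(2), of S] by simp_all
  define \<tau> where "\<tau> = sqrt (x1 * x2 / (y1 * y2))"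
  define f where "f = restrict_to_vertices vs
    (block_function X S (sqrt a) (sqrt a) (sqrt b) (sqrt b))"
  define g where "g = restrict_to_vertices vs
    (block_function X S (sqrt a * x2) (- sqrt a * x1) (sqrt b * \<tau> * y2) (- sqrt b * \<tau> * y1))"
  define h where "h s t = block_function X S (sqrt a * (s + t * x2)) (sqrt a * (s - t * x1))
    (sqrt b * (s + t * \<tau> * y2)) (sqrt b * (s - t * \<tau> * y1))" for s t
  have comb: "s \<cdot>\<^sub>v f + t \<cdot>\<^sub>v g = restrict_to_vertices vs (h s t)" for s t
    unfolding f_def g_def h_def restrict_to_vertices_def
    by (intro eq_vecI) (simp_all add: block_function_def algebra_simps)
  have norm: "restrict_to_vertices vs (h s t) \<bullet> restrict_to_vertices vs (h s t)
      = x1 * (sqrt a * (s + t * x2))\<^sup>2 + x2 * (sqrt a * (s - t * x1))\<^sup>2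
        + y1 * (sqrt b * (s + t * \<tau> * y2))\<^sup>2 + y2 * (sqrt b * (s - t * \<tau> * y1))\<^sup>2" for s t
    unfolding square_norm_restrict[OF vs(1)] vs(2) h_def block_function_square_sum[OF G]
      x1_def x2_def y1_def y2_def by simp
  note rayleigh = two_block_rayleigh[OF ab pos X1 X2 Y1 Y2 m, folded \<tau>_def]
  show ?thesis
  proof (rule courant_fischer_second_eigenvalue)
    show "adjacency_matrix vs E \<in> carrier_mat (length vs) (length vs)"
      by (simp add: adjacency_matrix_def)
    show "transpose_mat (adjacency_matrix vs E) = adjacency_matrix vs E"
      by (rule adjacency_matrix_symmetric)
    show "f \<in> carrier_vec (length vs)" "g \<in> carrier_vec (length vs)"
      by (simp_all add: f_def g_def restrict_to_vertices_def)
    show "s \<cdot>\<^sub>v f + t \<cdot>\<^sub>v g \<noteq> 0\<^sub>v (length vs)" if st: "(s, t) \<noteq> (0, 0)" for s t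
    proof
      assume zero: "s \<cdot>\<^sub>v f + t \<cdot>\<^sub>v g = 0\<^sub>v (length vs)"
      have "(s \<cdot>\<^sub>v f + t \<cdot>\<^sub>v g) \<bullet> (s \<cdot>\<^sub>v f + t \<cdot>\<^sub>v g) = 2 * real a * (x1 + x2) * (s\<^sup>2 + t\<^sup>2 * x1 * x2)"
        unfolding comb norm by (rule rayleigh(1))
      moreover have "0 < s\<^sup>2 + t\<^sup>2 * x1 * x2"
      proof (cases "s = 0")
        case True
        thus ?thesis using st pos by simp
      next
        case False
        thus ?thesis using pos by (intro add_pos_nonneg) auto
      qed
      ultimately show False
        unfolding zero using ab pos by (simp add: zero_less_mult_iff)
    qed
    show "let w = s \<cdot>\<^sub>v f + t \<cdot>\<^sub>v g in ?c * (w \<bullet> w) \<le> w \<bullet> (adjacency_matrix vs E *\<^sub>v w)" for s t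
      unfolding Let_def comb norm adjacency_quadratic_form[OF vs(1)] vs(2)
      unfolding h_def block_function_quadratic_form[OF G] cardX cardY m_def
      by (rule rayleigh(2))
  qed
qed

section \<open>The spectral criterion for edge connectivity\<close>

theorem theorem2p1:
  fixes X Y :: "'a set" and E :: "'a set set" and a b k :: nat and vs :: "'a list"
    and lambda2 :: real and \<alpha> \<beta> :: real
  assumes "k \<ge> 1"
    and "XYab_graph X Y a b E"
    and "a \<ge> k" and "b \<ge> k"
    and "distinct vs" and "set vs = X \<union> Y"
  defines "lambda2 \<equiv> nth_eigenvalue (adjacency_matrix vs E) 2"
    and "\<alpha> \<equiv> real_of_int \<lceil>(real a + 1) / 2\<rceil>"
    and "\<beta> \<equiv> real_of_int \<lceil>(real b + 1) / 2\<rceil>"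
  shows "(lambda2 < sqrt (real a * real b)
            - (real k - 1) * sqrt (real (card X) * real (card Y))
              / (2 * sqrt (\<alpha> * \<beta> * (real (card X) - \<beta>) * (real (card Y) - \<alpha>)))
          \<longrightarrow> edge_connectivity (X \<union> Y) E \<ge> k)
       \<and> (lambda2 < sqrt (real a * real b) - (real k - 1) / sqrt (\<alpha> * \<beta>)
          \<longrightarrow> edge_connectivity (X \<union> Y) E \<ge> k)"
proof -
  note G = assms(2)
  let ?first = "(real k - 1) * sqrt (real (card X) * real (card Y))
    / (2 * sqrt (\<alpha> * \<beta> * (real (card X) - \<beta>) * (real (card Y) - \<alpha>)))"
  let ?second = "(real k - 1) / sqrt (\<alpha> * \<beta>)"
  have "sqrt (real a * real b) - ?first \<le> lambda2 \<and> sqrt (real a * real b) - ?second \<le> lambda2"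
    if small: "edge_connectivity (X \<union> Y) E < k"
  proof -
    note fin = XYab_graph_finite[OF G]
    note G' = XYab_graph_swap[OF G]
    obtain S where S: "S \<inter> (X \<union> Y) \<noteq> {}" "(X \<union> Y) - S \<noteq> {}"
      and cut: "edge_count E (X \<inter> S) (Y - S) + edge_count E (X - S) (Y \<inter> S)
        \<le> real (edge_connectivity (X \<union> Y) E)"
      using small_cut_of_edge_connectivity[OF G] .
    let ?e11 = "edge_count E (X \<inter> S) (Y \<inter> S)" and ?e12 = "edge_count E (X \<inter> S) (Y - S)"
      and ?e21 = "edge_count E (X - S) (Y \<inter> S)" and ?e22 = "edge_count E (X - S) (Y - S)"
    define x1 x2 y1 y2 where "x1 = card (X \<inter> S)" and "x2 = card (X - S)"
      and "y1 = card (Y \<inter> S)" and "y2 = card (Y - S)"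
    note cards = x1_def x2_def y1_def y2_def
    have m: "?e12 + ?e21 \<le> real k - 1"
      using cut small by linarith
    hence mk: "?e12 + ?e21 < real k" "?e21 + ?e12 < real k"
      by linarith+
    have X1: "?e11 + ?e12 = real a * real x1" and X2: "?e22 + ?e21 = real a * real x2"
      unfolding cards add.commute[of ?e22] edge_count_split_right[OF fin(2)]
      by (intro edge_count_degree[OF G]; blast)+
    have Y1: "?e11 + ?e21 = real b * real y1" and Y2: "?e22 + ?e12 = real b * real y2"
      unfolding cards add.commute[of ?e22] edge_count_split_left[OF fin(1)] edge_count_commute[of E X]
      by (intro edge_count_degree[OF G']; blast)+
    have nonempty: "0 < x1 \<or> 0 < y1" "0 < x2 \<or> 0 < y2"
      unfolding cards using S fin by (auto simp: card_gt_0_iff)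
    have bounds: "?e11 \<le> real x1 * real y1" "?e22 \<le> real x2 * real y2"
      unfolding cards by (rule edge_count_le)+
    have ak: "real k \<le> real a" "real k \<le> real b"
      using assms(3,4) by simp_all
    note nonneg = edge_count_nonneg
    have y1: "\<alpha> \<le> real y1"
      unfolding \<alpha>_def using small_cut_part_size[OF nonempty(1) ak bounds(1) nonneg nonneg X1 Y1 mk(1)] .
    have y2: "\<alpha> \<le> real y2"
      unfolding \<alpha>_def using small_cut_part_size[OF nonempty(2) ak bounds(2) nonneg nonneg X2 Y2 mk(2)] .
    have x1: "\<beta> \<le> real x1"
      unfolding \<beta>_def using nonempty(1) bounds(1)
      by (intro small_cut_part_size[OF _ ak(2,1) _ nonneg nonneg Y1 X1 mk(2)]) (auto simp: mult.commute)
    have x2: "\<beta> \<le> real x2"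
      unfolding \<beta>_def using nonempty(2) bounds(2)
      by (intro small_cut_part_size[OF _ ak(2,1) _ nonneg nonneg Y2 X2 mk(1)]) (auto simp: mult.commute)
    have \<alpha>: "0 < \<alpha>" and \<beta>: "0 < \<beta>"
      unfolding \<alpha>_def \<beta>_def by (simp_all add: add_pos_nonneg)
    have cardX: "real (card X) = real x1 + real x2" and cardY: "real (card Y) = real y1 + real y2"
      unfolding cards using card_Int_Diff[OF fin(1), of S] card_Int_Diff[OF fin(2), of S] by simp_all
    let ?D = "sqrt (\<alpha> * \<beta> * (real (card X) - \<beta>) * (real (card Y) - \<alpha>))"
    \<comment> \<open>The product of two numbers with given sum is smallest when one of them is as small as possible.\<close>
    have split: "u * (p + q - u) \<le> p * q" if "u \<le> p" "u \<le> q" for u p q :: real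
      using mult_nonneg_nonneg[of "p - u" "q - u"] that by (simp add: algebra_simps)
    have "\<alpha> * \<beta> * (real (card X) - \<beta>) * (real (card Y) - \<alpha>)
        = (\<beta> * (real x1 + real x2 - \<beta>)) * (\<alpha> * (real y1 + real y2 - \<alpha>))"
      unfolding cardX cardY by (simp add: ac_simps)
    also have "\<dots> \<le> (real x1 * real x2) * (real y1 * real y2)"
      using x1 x2 y1 y2 \<alpha> \<beta> by (intro mult_mono split) auto
    finally have D_le: "?D \<le> sqrt (real x1 * real x2 * real y1 * real y2)"
      by (simp add: mult.assoc)
    have D_pos: "0 < ?D"
      using x1 x2 y1 y2 \<alpha> \<beta> by (simp add: cardX cardY)
    have pos: "0 < real x1" "0 < real x2" "0 < real y1" "0 < real y2"
      using x1 x2 y1 y2 \<alpha> \<beta> by linarith+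
    have "(?e12 + ?e21) * sqrt (real (card X) * real (card Y)) / (2 * sqrt (real x1 * real x2 * real y1 * real y2))
        \<le> ?first"
      using m D_le D_pos nonneg assms(1) by (intro frac_le mult_right_mono) auto
    moreover have "sqrt (real a * real b) - (?e12 + ?e21) * sqrt (real (card X) * real (card Y))
        / (2 * sqrt (real x1 * real x2 * real y1 * real y2)) \<le> lambda2"
      unfolding lambda2_def cards
      using second_eigenvalue_ge_of_cut[OF G assms(5,6)] pos[unfolded cards] .
    ultimately have first: "sqrt (real a * real b) - ?first \<le> lambda2"
      by linarith
    \<comment> \<open>Both parts have at least \<open>\<beta>\<close> vertices in \<open>X\<close> and \<open>\<alpha>\<close> in \<open>Y\<close>, so \<open>|X| \<le> 2 (|X| - \<beta>)\<close> and \<open>|Y| \<le> 2 (|Y| - \<alpha>)\<close>.\<close>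
    have "?first \<le> ?second"
    proof -
      have half: "real (card X) * real (card Y) \<le> (2 * (real (card X) - \<beta>)) * (2 * (real (card Y) - \<alpha>))"
        using x1 x2 y1 y2 by (intro mult_mono) (auto simp: cardX cardY)
      have "sqrt (real (card X) * real (card Y)) * sqrt (\<alpha> * \<beta>)
          = sqrt (real (card X) * real (card Y) * (\<alpha> * \<beta>))"
        by (simp add: real_sqrt_mult)
      also have "\<dots> \<le> sqrt ((2 * (real (card X) - \<beta>)) * (2 * (real (card Y) - \<alpha>)) * (\<alpha> * \<beta>))"
        using half \<alpha> \<beta> by (intro real_sqrt_le_mono mult_right_mono) auto
      also have "\<dots> = sqrt (2\<^sup>2 * (\<alpha> * \<beta> * (real (card X) - \<beta>) * (real (card Y) - \<alpha>)))"
        by (simp add: algebra_simps)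
      also have "\<dots> = 2 * ?D"
        by (simp only: real_sqrt_mult real_sqrt_abs)
      finally have "sqrt (real (card X) * real (card Y)) / (2 * ?D) \<le> 1 / sqrt (\<alpha> * \<beta>)"
        using D_pos \<alpha> \<beta> by (simp add: field_simps)
      from mult_left_mono[OF this, of "real k - 1"] assms(1) show ?thesis
        by simp
    qed
    thus ?thesis
      using first by linarith
  qed
  thus ?thesis
    by (meson not_le)
qed

end
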